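(* Let $\beta$ be a number and let $c_n=\beta^n C_n$ for $n\ge 0$, where $C_n$ is the $n$-th Catalan number. Let $k\ge 1$ be an integer. Then for every $l=0,1,\ldots,k-1$, $$\det[c_{i+j+\chi(j\ge l)}]_{0\le i,j\le k-1}=\beta^{k^2-l}\binom{l+k}{2l}.$$
   Context: $C_n=\frac{1}{n+1}\binom{2n}{n}$ is the $n$-th Catalan number. For a statement $P$, $\chi(P)=1$ if $P$ is true and $\chi(P)=0$ otherwise. *)

theory Defs
  imports "Jordan_Normal_Form.Determinant"
begin

definition catalan :: "nat \<Rightarrow> 'a::field_char_0" where
  "catalan n = 1 / (of_nat n + 1) * of_nat ((2 * n) choose n)"

end

theory Submission
  imports Defs
begin

text \<open>
  The coefficients \<open>(-1)\<^bsup>k+j\<^esup> (k+j choose 2j)\<close> are those of the monic polynomials orthogonal with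
  respect to the Catalan moments, with recurrence \<open>P\<^bsub>k+2\<^esub> = (x - 2) P\<^bsub>k+1\<^esub> - P\<^bsub>k\<^esub>\<close>. Pairing
  \<open>x\<^sup>i P\<^sub>k\<close> with the moments gives the ballot number \<open>(2i choose i+k) - (2i choose i+k+1)\<close>, which
  is \<open>0\<close> for \<open>i < k\<close> and \<open>1\<close> for \<open>i = k\<close>. The case \<open>i = k\<close> evaluates the Hankel determinant
  without a gap; the case \<open>i < k\<close> expresses column \<open>k\<close> of the moment matrix through the earlier
  columns, so that only its component along the missing column \<open>l\<close> contributes.
\<close>

section \<open>Determinants under linear relations between columns\<close>

text \<open>Right multiplication by the unit upper triangular \<open>U\<close> turns the last column
  into \<open>h\<close> times the last unit vector; expanding along it leaves the smaller
  determinant.\<close>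

lemma det_mat_Suc_column_relation:
  fixes f :: "nat \<Rightarrow> nat \<Rightarrow> 'a::idom"
  assumes q: "q k = 1"
    and rel: "\<And>i. i < k \<Longrightarrow> (\<Sum>j\<le>k. f i j * q j) = 0"
    and last: "(\<Sum>j\<le>k. f k j * q j) = h"
  shows "det (mat (Suc k) (Suc k) (\<lambda>(i, j). f i j)) = h * det (mat k k (\<lambda>(i, j). f i j))"
proof -
  define A where "A = mat (Suc k) (Suc k) (\<lambda>(i, j). f i j)"
  define U where "U = mat (Suc k) (Suc k) (\<lambda>(i, j). if j = k then q i else of_bool (i = j))"
  define B where "B = mat (Suc k) (Suc k) (\<lambda>(i, j). if j = k then (if i = k then h else 0) else f i j)"
  have carr: "A \<in> carrier_mat (Suc k) (Suc k)" "U \<in> carrier_mat (Suc k) (Suc k)"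
    "B \<in> carrier_mat (Suc k) (Suc k)"
    by (auto simp: A_def U_def B_def)
  have "A * U = B"
  proof (rule eq_matI)
    fix i j assume "i < dim_row B" "j < dim_col B"
    then have ij: "i < Suc k" "j < Suc k" by (auto simp: B_def)
    have "(A * U) $$ (i, j) = (\<Sum>m\<le>k. f i m * (if j = k then q m else of_bool (m = j)))"
      using ij by (simp add: A_def U_def scalar_prod_def atLeast0LessThan lessThan_Suc_atMost)
    also have "\<dots> = B $$ (i, j)"
    proof (cases "j = k")
      case True
      then show ?thesis using ij rel[of i] last by (auto simp: B_def less_Suc_eq)
    next
      case False
      then show ?thesis using ij
        by (simp add: B_def of_bool_def if_distrib[of "\<lambda>x. _ * x"] sum.delta cong: if_cong)
    qed
    finally show "(A * U) $$ (i, j) = B $$ (i, j)" .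
  qed (auto simp: A_def U_def B_def)
  moreover have "det U = 1"
  proof -
    have "upper_triangular U" by (auto simp: U_def)
    moreover have "diag_mat U = replicate (Suc k) 1"
      by (rule nth_equalityI) (use q in \<open>auto simp: diag_mat_def U_def simp del: upt_Suc replicate_Suc\<close>)
    ultimately show ?thesis using det_upper_triangular[OF _ carr(2)] by simp
  qed
  ultimately have "det A = det B"
    using det_mult[OF carr(1,2)] by simp
  also have "\<dots> = (\<Sum>i<Suc k. B $$ (i, k) * cofactor B i k)"
    by (rule laplace_expansion_column[OF carr(3)]) simp
  also have "\<dots> = h * cofactor B k k"
    by (simp add: B_def)
  also have "mat_delete B k k = mat k k (\<lambda>(i, j). f i j)"
    by (rule eq_matI) (auto simp: mat_delete_def B_def)
  then have "cofactor B k k = det (mat k k (\<lambda>(i, j). f i j))"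
    by (simp add: cofactor_def flip: mult_2)
  finally show ?thesis by (simp add: A_def)
qed

text \<open>The relation writes column \<open>k\<close> as minus the \<open>q\<close>-combination of
  the earlier columns, so the gapped matrix factors as \<open>A * Q\<close>.\<close>

lemma det_mat_skip_column_relation:
  fixes f :: "nat \<Rightarrow> nat \<Rightarrow> 'a::idom"
  assumes l: "l < k" and q: "q k = 1"
    and rel: "\<And>i. i < k \<Longrightarrow> (\<Sum>j\<le>k. f i j * q j) = 0"
  shows "det (mat k k (\<lambda>(i, j). f i (j + of_bool (l \<le> j)))) =
    (-1) ^ (k + l) * q l * det (mat k k (\<lambda>(i, j). f i j))"
proof -
  obtain n where k: "k = Suc n" using l by (cases k) auto
  define A where "A = mat k k (\<lambda>(i, j). f i j)"
  define Q where "Q = mat k k (\<lambda>(i, j). if j = n then - q i else of_bool (i = j + of_bool (l \<le> j)))"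
  define B where "B = mat k k (\<lambda>(i, j). f i (j + of_bool (l \<le> j)))"
  have carr: "A \<in> carrier_mat k k" "Q \<in> carrier_mat k k" by (auto simp: A_def Q_def)
  have "A * Q = B"
  proof (rule eq_matI)
    fix i j assume "i < dim_row B" "j < dim_col B"
    then have ij: "i < k" "j < k" by (auto simp: B_def)
    have "(A * Q) $$ (i, j) =
        (\<Sum>m<k. f i m * (if j = n then - q m else of_bool (m = j + of_bool (l \<le> j))))"
      using ij by (simp add: A_def Q_def scalar_prod_def atLeast0LessThan)
    also have "\<dots> = B $$ (i, j)"
    proof (cases "j = n")
      case True
      have "(\<Sum>m<k. f i m * q m) + f i k = 0"
        using rel[OF ij(1)] q by (simp flip: lessThan_Suc_atMost)
      then have "(\<Sum>m<k. f i m * - q m) = f i k"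
        by (simp add: sum_negf neg_eq_iff_add_eq_0)
      then show ?thesis using True ij l k
        by (simp add: B_def del: sum.lessThan_Suc)
    next
      case False
      then have "j + of_bool (l \<le> j) < k" using ij k by auto
      then show ?thesis using False ij
        by (simp add: B_def of_bool_def if_distrib[of "\<lambda>x. _ * x"] sum.delta cong: if_cong)
    qed
    finally show "(A * Q) $$ (i, j) = B $$ (i, j)" .
  qed (auto simp: A_def Q_def B_def)
  then have "det B = det A * det Q" using det_mult[OF carr] by simp
  also have "det Q = (\<Sum>j<k. Q $$ (l, j) * cofactor Q l j)"
    by (rule laplace_expansion_row[OF carr(2) l])
  \<comment> \<open>Only the last entry of row \<open>l\<close> can be nonzero:
    \<open>j + of_bool (l \<le> j)\<close> never equals \<open>l\<close>.\<close>
  also have "\<dots> = (\<Sum>j<k. if j = n then - q l * cofactor Q l n else 0)"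
    by (rule sum.cong) (use l in \<open>auto simp: Q_def\<close>)
  also have "\<dots> = - q l * cofactor Q l n" using k by simp
  also have "mat_delete Q l n = 1\<^sub>m n"
    by (rule eq_matI) (use l in \<open>auto simp: mat_delete_def Q_def k\<close>)
  then have "cofactor Q l n = (-1) ^ (l + n)" by (simp add: cofactor_def)
  \<comment> \<open>As \<open>k = Suc n\<close>, the minus sign in \<open>- q l\<close> turns
    \<open>(-1) ^ (l + n)\<close> into \<open>(-1) ^ (k + l)\<close>.\<close>
  finally show ?thesis by (simp add: A_def B_def k algebra_simps power_add)
qed

section \<open>Ballot numbers\<close>

text \<open>By reflection, this counts the nonnegative paths of \<open>2 * i\<close> unit steps up
  or down from height 0 to height \<open>2 * k\<close>.\<close>

definition ballot :: "nat \<Rightarrow> nat \<Rightarrow> 'a::field_char_0" where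
  "ballot i k = of_nat ((2 * i) choose (i + k)) - of_nat ((2 * i) choose (i + k + 1))"

lemma choose_Suc_Suc_twice:
  "(n + 2) choose (m + 2) = (n choose m) + 2 * (n choose (m + 1)) + (n choose (m + 2))"
  by (simp add: numeral_2_eq_2)

text \<open>This is the recurrence of \<open>orth_coeff\<close> stripped of its signs.\<close>

lemma choose_three_term:
  "((n + 2) choose (m + 2)) + (n choose (m + 2)) = (n choose m) + 2 * ((n + 1) choose (m + 2))"
  by (simp add: numeral_2_eq_2)

lemma ballot_Suc_Suc:
  "ballot (Suc i) (Suc k) = ballot i k + 2 * ballot i (Suc k) + ballot i (Suc (Suc k))"
  using choose_Suc_Suc_twice[of "2 * i" "i + k"] choose_Suc_Suc_twice[of "2 * i" "i + k + 1"]
  by (simp add: ballot_def algebra_simps)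

text \<open>At height 0 the detour down and up is forbidden, so the weight 2 of the interior
  recurrence drops to 1.\<close>

lemma ballot_Suc_0: "ballot (Suc i) 0 = ballot i 0 + ballot i 1"
proof (cases i)
  case 0
  then show ?thesis by (simp add: ballot_def numeral_2_eq_2)
next
  case (Suc n)
  \<comment> \<open>Here \<open>n = i - 1\<close> and \<open>n + 2 = i + 1\<close> lie symmetrically
    about the middle of row \<open>2 * i\<close>.\<close>
  have "(2 * i) choose n = (2 * i) choose (n + 2)"
    using binomial_symmetric[of n "2 * i"] Suc by simp
  then show ?thesis
    using choose_Suc_Suc_twice[of "2 * i" n] choose_Suc_Suc_twice[of "2 * i" i] Suc
    by (simp add: ballot_def algebra_simps)
qed

lemma ballot_eq_0: "i < k \<Longrightarrow> ballot i k = 0"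
  by (simp add: ballot_def binomial_eq_0)

lemma ballot_self: "ballot k k = 1"
  by (simp add: ballot_def binomial_eq_0 flip: mult_2)

lemma catalan_eq_ballot: "catalan n = ballot n 0"
proof -
  have "Suc n * ((2 * n) choose Suc n) = (2 * n - n) * ((2 * n) choose n)"
    by (simp only: binomial_absorption binomial_absorb_comp)
  also have "2 * n - n = n" by simp
  finally have "(of_nat n + 1) * (of_nat ((2 * n) choose Suc n) :: 'a) = of_nat n * of_nat ((2 * n) choose n)"
    by (metis of_nat_Suc of_nat_mult add.commute)
  moreover have "(of_nat n + 1 :: 'a) \<noteq> 0"
    by (metis of_nat_Suc of_nat_eq_0_iff add.commute nat.distinct(1))
  ultimately show ?thesis
    by (simp add: catalan_def ballot_def field_simps)
qed

section \<open>Orthogonal polynomials of the Catalan moments\<close>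

text \<open>The polynomial is \<open>U_{2k}(sqrt(x)/2)\<close>, with \<open>U\<close> the Chebyshev
  polynomials of the second kind. The binomial vanishes for \<open>j > k\<close>.\<close>

definition orth_coeff :: "nat \<Rightarrow> nat \<Rightarrow> 'a::field_char_0" where
  "orth_coeff k j = (-1) ^ (k + j) * of_nat ((k + j) choose (2 * j))"

lemma orth_coeff_Suc_Suc_0:
  "orth_coeff (Suc (Suc k)) 0 = - 2 * orth_coeff (Suc k) 0 - orth_coeff k 0"
  by (simp add: orth_coeff_def)

lemma orth_coeff_Suc_Suc_Suc:
  "orth_coeff (Suc (Suc k)) (Suc j) =
    orth_coeff (Suc k) j - 2 * orth_coeff (Suc k) (Suc j) - orth_coeff k (Suc j)"
proof -
  have "((k + j + 3) choose (2 * j + 2)) + ((k + j + 1) choose (2 * j + 2)) =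
      ((k + j + 1) choose (2 * j)) + 2 * ((k + j + 2) choose (2 * j + 2))"
    using choose_three_term[of "k + j + 1" "2 * j"]
    by (simp add: numeral_eq_Suc del: binomial_Suc_Suc)
  then have "(of_nat ((k + j + 3) choose (2 * j + 2)) :: 'a) + of_nat ((k + j + 1) choose (2 * j + 2)) =
      of_nat ((k + j + 1) choose (2 * j)) + 2 * of_nat ((k + j + 2) choose (2 * j + 2))"
    by (metis of_nat_add of_nat_mult of_nat_numeral)
  then have choose: "(of_nat ((k + j + 3) choose (2 * j + 2)) :: 'a) =
      of_nat ((k + j + 1) choose (2 * j)) + 2 * of_nat ((k + j + 2) choose (2 * j + 2))
      - of_nat ((k + j + 1) choose (2 * j + 2))"
    by (simp add: eq_diff_eq)
  define s :: 'a where "s = (-1) ^ (k + j)"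
  have coeffs: "orth_coeff (Suc (Suc k)) (Suc j) = - s * of_nat ((k + j + 3) choose (2 * j + 2))"
    "orth_coeff (Suc k) j = - s * of_nat ((k + j + 1) choose (2 * j))"
    "orth_coeff (Suc k) (Suc j) = s * of_nat ((k + j + 2) choose (2 * j + 2))"
    "orth_coeff k (Suc j) = - s * of_nat ((k + j + 1) choose (2 * j + 2))"
    by (simp_all add: s_def orth_coeff_def numeral_3_eq_3 del: binomial_Suc_Suc)
  show ?thesis unfolding coeffs choose by (simp add: algebra_simps del: binomial_Suc_Suc)
qed

text \<open>Both sides obey the same recurrence in \<open>k\<close>, multiplication by
  \<open>x\<close> being the shift from \<open>i\<close> to \<open>Suc i\<close>. The free bound
  \<open>N\<close> lets sums of different degrees share one range.\<close>

lemma sum_catalan_orth_coeff_upto: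
  "k \<le> N \<Longrightarrow> (\<Sum>j\<le>N. catalan (i + j) * orth_coeff k j) = (ballot i k :: 'a::field_char_0)"
proof (induction k arbitrary: i N rule: induct_nat_012)
  case 0
  have "(\<Sum>j\<le>N. catalan (i + j) * orth_coeff 0 j) =
      (\<Sum>j\<le>N. if j = 0 then catalan i else (0::'a))"
    by (rule sum.cong) (auto simp: orth_coeff_def binomial_eq_0)
  then show ?case by (simp add: catalan_eq_ballot)
next
  case 1
  then obtain M where N: "N = Suc M" by (cases N) auto
  have "(\<Sum>j\<le>M. catalan (i + Suc j) * orth_coeff 1 (Suc j)) =
      (\<Sum>j\<le>M. if j = 0 then catalan (Suc i) else (0::'a))"
    by (rule sum.cong) (auto simp: orth_coeff_def binomial_eq_0)
  then show ?case
    by (simp add: N sum.atMost_Suc_shift catalan_eq_ballot ballot_Suc_0 orth_coeff_def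
        del: sum.atMost_Suc)
next
  case (ge2 k)
  then obtain M where N: "N = Suc M" "Suc k \<le> M" by (cases N) auto
  have "(\<Sum>j\<le>N. catalan (i + j) * orth_coeff (Suc (Suc k)) j :: 'a) =
      (\<Sum>j\<le>M. catalan (Suc i + j) * orth_coeff (Suc k) j)
      - 2 * (\<Sum>j\<le>N. catalan (i + j) * orth_coeff (Suc k) j)
      - (\<Sum>j\<le>N. catalan (i + j) * orth_coeff k j)"
    \<comment> \<open>The term \<open>j = 0\<close> is split off because the constant coefficient
      receives nothing from the product with \<open>x\<close>.\<close>
    unfolding N(1) sum.atMost_Suc_shift orth_coeff_Suc_Suc_0 orth_coeff_Suc_Suc_Suc
    by (simp add: algebra_simps sum.distrib sum_subtractf sum_distrib_left)
  also have "\<dots> = ballot (Suc i) (Suc k) - 2 * ballot i (Suc k) - ballot i k"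
  proof -
    have "k \<le> N" "Suc k \<le> N" using N by auto
    then show ?thesis by (simp only: ge2.IH N(2))
  qed
  also have "\<dots> = ballot i (Suc (Suc k))" by (simp add: ballot_Suc_Suc)
  finally show ?case .
qed

lemma sum_catalan_orth_coeff: "(\<Sum>j\<le>k. catalan (i + j) * orth_coeff k j) = ballot i k"
  by (rule sum_catalan_orth_coeff_upto) simp

text \<open>The scaled coefficients are those of \<open>\<beta>^k P_k(x/\<beta>)\<close>, written
  without division so that \<beta> = 0 is covered.\<close>

lemma sum_scaled_catalan_orth_coeff:
  fixes \<beta> :: "'a::field_char_0"
  shows "(\<Sum>j\<le>k. \<beta> ^ (i + j) * catalan (i + j) * (\<beta> ^ (k - j) * orth_coeff k j)) =
    \<beta> ^ (i + k) * ballot i k"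
proof -
  have "\<beta> ^ (i + j) * catalan (i + j) * (\<beta> ^ (k - j) * orth_coeff k j) =
      \<beta> ^ (i + k) * (catalan (i + j) * orth_coeff k j)" if "j \<le> k" for j
  proof -
    have "\<beta> ^ (i + k) = \<beta> ^ (i + j) * \<beta> ^ (k - j)" using that by (simp flip: power_add)
    then show ?thesis by simp
  qed
  then show ?thesis
    unfolding sum_catalan_orth_coeff[symmetric] sum_distrib_left by (intro sum.cong) auto
qed

section \<open>Evaluation of the determinants\<close>

lemma det_hankel_scaled_catalan:
  fixes \<beta> :: "'a::field_char_0"
  shows "det (mat k k (\<lambda>(i, j). \<beta> ^ (i + j) * catalan (i + j))) = \<beta> ^ (k * (k - 1))"
proof (induction k)
  case 0
  then show ?case by simp
next
  case (Suc k)
  have "det (mat (Suc k) (Suc k) (\<lambda>(i, j). \<beta> ^ (i + j) * catalan (i + j))) =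
      \<beta> ^ (k + k) * det (mat k k (\<lambda>(i, j). \<beta> ^ (i + j) * catalan (i + j)))"
    by (rule det_mat_Suc_column_relation[where q = "\<lambda>j. \<beta> ^ (k - j) * orth_coeff k j"])
      (simp_all add: sum_scaled_catalan_orth_coeff ballot_eq_0 ballot_self,
       simp add: orth_coeff_def flip: mult_2)
  also have "\<dots> = \<beta> ^ (Suc k * (Suc k - 1))"
    unfolding Suc.IH power_add[symmetric] by (cases k) (simp_all add: algebra_simps)
  finally show ?case .
qed

theorem lemma7p3:
  fixes \<beta> :: "'a::field_char_0" and c :: "nat \<Rightarrow> 'a" and k l :: nat
  assumes "\<And>n. c n = \<beta> ^ n * catalan n"
    and "k \<ge> 1"
    and "l \<in> {0..k - 1}"
  shows "det (mat k k (\<lambda>(i, j). c (i + j + of_bool (j \<ge> l)))) =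
    \<beta> ^ (k\<^sup>2 - l) * of_nat ((l + k) choose (2 * l))"
proof -
  have l: "l < k" using assms(2,3) by auto
  \<comment> \<open>This keeps the natural-number subtraction in \<open>k * k - k\<close> from
    truncating.\<close>
  have "k \<le> k * k" by simp
  then have exponent: "k - l + k * (k - 1) = k\<^sup>2 - l"
    using l by (simp add: power2_eq_square diff_mult_distrib2)
  have "det (mat k k (\<lambda>(i, j). c (i + (j + of_bool (l \<le> j))))) =
      (-1) ^ (k + l) * (\<beta> ^ (k - l) * orth_coeff k l) * det (mat k k (\<lambda>(i, j). c (i + j)))"
    by (rule det_mat_skip_column_relation[OF l, where q = "\<lambda>j. \<beta> ^ (k - j) * orth_coeff k j"])
      (simp_all add: assms(1) sum_scaled_catalan_orth_coeff ballot_eq_0,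
       simp add: orth_coeff_def flip: mult_2)
  also have "det (mat k k (\<lambda>(i, j). c (i + j))) = \<beta> ^ (k * (k - 1))"
    by (simp add: assms(1) det_hankel_scaled_catalan)
  also have "(-1) ^ (k + l) * (\<beta> ^ (k - l) * orth_coeff k l) * \<beta> ^ (k * (k - 1)) =
      ((-1) ^ (k + l) * (-1) ^ (k + l)) * \<beta> ^ (k - l + k * (k - 1)) * of_nat ((l + k) choose (2 * l))"
    by (simp only: orth_coeff_def power_add[of \<beta>] add.commute[of l k] ac_simps)
  \<comment> \<open>The sign from the skipped column cancels the sign of
    \<open>orth_coeff k l\<close>.\<close>
  also have "(-1) ^ (k + l) * (-1) ^ (k + l) = (1 :: 'a)"
    by (simp flip: power_mult_distrib)
  finally show ?thesis unfolding exponent by (simp add: add.assoc)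
qed

end
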